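(* Let $X$ be an ordered set such that the duplication of $X$ is representable, and for every $x\in X$ let $Y_x$ be a representable ordered set. Then the ordered set obtained by replacing every $x\in X$ by $Y_x$, that is, $\{(x,y):x\in X,\ y\in Y_x\}$ with the lexicographical ordering, is representable.
   Context: "Ordered set" means linearly ordered set. Two ordered sets are similar if there is an order preserving bijection between them. Real valued functions are partially ordered pointwise: $f\le g$ iff $f(x)\le g(x)$ for all $x$. An ordered set is representable if it is similar to a set of Baire 1 functions $\mathbb{R}\to\mathbb{R}$ that is linearly ordered by the pointwise ordering. The duplication of an ordered set $X$ is $X\times\{0,1\}$ with the lexicographical ordering. *)

theory Defs
  imports "HOL-Analysis.Analysis"
begin

text \<open>An ordered set is a carrier \<open>A\<close> with a reflexive order relation \<open>r\<close> such that
  \<^term>\<open>linear_order_on A r\<close>; this includes \<open>r \<subseteq> A \<times> A\<close>.\<close>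

definition similar :: "'a set \<Rightarrow> 'a rel \<Rightarrow> 'b set \<Rightarrow> 'b rel \<Rightarrow> bool" where
  "similar A r B s \<longleftrightarrow>
     (\<exists>f. bij_betw f A B \<and> (\<forall>x\<in>A. \<forall>y\<in>A. (x, y) \<in> r \<longleftrightarrow> (f x, f y) \<in> s))"

text \<open>The order of the type, restricted to \<open>A\<close>. On functions \<open>\<le>\<close> is the pointwise order.\<close>

definition type_order_on :: "'a::ord set \<Rightarrow> 'a rel" where
  "type_order_on A = {(x, y). x \<in> A \<and> y \<in> A \<and> x \<le> y}"

definition baire1 :: "(real \<Rightarrow> real) \<Rightarrow> bool" where
  "baire1 f \<longleftrightarrow>
     (\<exists>g :: nat \<Rightarrow> real \<Rightarrow> real. (\<forall>n. continuous_on UNIV (g n)) \<and>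
        (\<forall>x. (\<lambda>n. g n x) \<longlonglongrightarrow> f x))"

definition representable :: "'a set \<Rightarrow> 'a rel \<Rightarrow> bool" where
  "representable A r \<longleftrightarrow>
     (\<exists>F :: (real \<Rightarrow> real) set. (\<forall>f\<in>F. baire1 f) \<and>
        linear_order_on F (type_order_on F) \<and> similar A r F (type_order_on F))"

definition lex_order ::
  "'a set \<Rightarrow> 'a rel \<Rightarrow> ('a \<Rightarrow> 'b set) \<Rightarrow> ('a \<Rightarrow> 'b rel) \<Rightarrow> ('a \<times> 'b) rel" where
  "lex_order X r Y s =
     {((x, y), (x', y')). (x, y) \<in> Sigma X Y \<and> (x', y') \<in> Sigma X Y \<and>
        (x \<noteq> x' \<and> (x, x') \<in> r \<or> x = x' \<and> (y, y') \<in> s x)}"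

definition duplication_order :: "'a set \<Rightarrow> 'a rel \<Rightarrow> ('a \<times> nat) rel" where
  "duplication_order X r = lex_order X r (\<lambda>_. {0, 1}) (\<lambda>_. type_order_on {0, 1})"

lemma linear_order_on_lex_order:
  assumes X: "linear_order_on X r" and Y: "\<And>x. x \<in> X \<Longrightarrow> linear_order_on (Y x) (s x)"
  shows "linear_order_on (Sigma X Y) (lex_order X r Y s)"
proof -
  have X': "trans r" "antisym r" "total_on X r"
    using X by (auto simp: order_on_defs)
  have Y': "refl_on (Y x) (s x)" "trans (s x)" "antisym (s x)" "total_on (Y x) (s x)"
    if "x \<in> X" for x
    using Y[OF that] by (auto simp: order_on_defs)
  have "refl_on (Sigma X Y) (lex_order X r Y s)"
    using Y'(1) by (auto simp: refl_on_def lex_order_def)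
  moreover have "lex_order X r Y s \<subseteq> Sigma X Y \<times> Sigma X Y"
    by (auto simp: lex_order_def)
  moreover have "trans (lex_order X r Y s)"
  proof (rule transI)
    fix p q t
    assume "(p, q) \<in> lex_order X r Y s" "(q, t) \<in> lex_order X r Y s"
    then show "(p, t) \<in> lex_order X r Y s"
      using antisymD[OF X'(2), of "fst p" "fst q"] transD[OF X'(1), of "fst p" "fst q" "fst t"]
        transD[OF Y'(2), of "fst p" "snd p" "snd q" "snd t"]
      by (cases p; cases q; cases t) (auto simp: lex_order_def)
  qed
  moreover have "antisym (lex_order X r Y s)"
  proof (rule antisymI)
    fix p q
    assume "(p, q) \<in> lex_order X r Y s" "(q, p) \<in> lex_order X r Y s"
    then show "p = q"
      using antisymD[OF X'(2), of "fst p" "fst q"] antisymD[OF Y'(3), of "fst p" "snd p" "snd q"]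
      by (cases p; cases q) (auto simp: lex_order_def)
  qed
  moreover have "total_on (Sigma X Y) (lex_order X r Y s)"
  proof (rule total_onI)
    fix p q
    assume "p \<in> Sigma X Y" "q \<in> Sigma X Y" "p \<noteq> q"
    then show "(p, q) \<in> lex_order X r Y s \<or> (q, p) \<in> lex_order X r Y s"
      using X'(3)[unfolded total_on_def, rule_format, of "fst p" "fst q"]
        Y'(4)[unfolded total_on_def, rule_format, of "fst p" "snd p" "snd q"]
      by (cases p; cases q) (auto simp: lex_order_def)
  qed
  ultimately show ?thesis by (simp add: order_on_defs)
qed

end

theory Submission
  imports Defs
begin

text \<open>The representation of the duplication of \<open>X\<close> gives Baire 1 functions \<open>f\<^sub>x < g\<^sub>x\<close> with
  \<open>g\<^sub>x \<le> f\<^sub>x\<^sub>'\<close> whenever \<open>x < x'\<close>, so it suffices to squeeze a copy of \<open>Y\<^sub>x\<close> above \<open>f\<^sub>x\<close> and strictly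
  below \<open>g\<^sub>x\<close>. The functions \<open>f\<^sub>x\<close> and \<open>g\<^sub>x\<close> may differ at one point \<open>c\<^sub>x\<close> only; to make room there,
  pass to the plane: regard \<open>f\<^sub>x\<close> and \<open>g\<^sub>x\<close> as functions of the first coordinate, and for
  \<open>y \<in> Y\<^sub>x\<close>, represented by \<open>h\<^sub>y\<close>, redefine \<open>f\<^sub>x\<close> on the closed line \<open>{c\<^sub>x} \<times> \<real>\<close> to be
  \<open>h\<^sub>y\<close> of the second coordinate, rescaled into the open interval \<open>(f\<^sub>x c\<^sub>x, g\<^sub>x c\<^sub>x)\<close>. Modifying a
  Baire 1 function on a closed set by another one gives a Baire 1 function
  (\<open>baire1_if_eq\<close>).

  To return to the line, compose with a continuous surjection \<open>\<real> \<rightarrow> \<real>\<^sup>2\<close>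
  (\<open>continuous_surjection_plane\<close>): composition with it preserves Baire 1 functions and, by
  surjectivity, the strict pointwise order. The surjection is built from Schoenberg's
  space-filling curve, whose coordinates read off the odd and the even ternary digits of
  a point of the Cantor set.\<close>

section \<open>Baire 1 functions\<close>

lemma baire1_compose_right:
  assumes "baire1 f" "continuous_on UNIV \<phi>"
  shows "baire1 (\<lambda>t. f (\<phi> t))"
proof -
  obtain g where g: "\<And>n. continuous_on UNIV (g n)" "\<And>x. (\<lambda>n. g n x) \<longlonglongrightarrow> f x"
    using assms(1) unfolding baire1_def by blast
  have "continuous_on UNIV (\<lambda>t. g n (\<phi> t))" for n
    using continuous_on_compose2[OF g(1) assms(2)] by simp
  with g(2) show ?thesis
    unfolding baire1_def by (intro exI[of _ "\<lambda>n t. g n (\<phi> t)"]) auto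
qed

lemma baire1_compose_left:
  assumes "baire1 f" "continuous_on UNIV \<phi>"
  shows "baire1 (\<lambda>t. \<phi> (f t))"
proof -
  obtain g where g: "\<And>n. continuous_on UNIV (g n)" "\<And>x. (\<lambda>n. g n x) \<longlonglongrightarrow> f x"
    using assms(1) unfolding baire1_def by blast
  have "continuous_on UNIV (\<lambda>t. \<phi> (g n t))" for n
    using continuous_on_compose2[OF assms(2) g(1)] by simp
  moreover have "(\<lambda>n. \<phi> (g n t)) \<longlonglongrightarrow> \<phi> (f t)" for t
    using continuous_on_tendsto_compose[OF assms(2) g(2)] by simp
  ultimately show ?thesis
    unfolding baire1_def by (intro exI[of _ "\<lambda>n t. \<phi> (g n t)"]) auto
qed

text \<open>The approximations are glued by continuous functions that decrease to the indicator
  function of the closed set \<open>{t. a t = c}\<close>.\<close>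

lemma baire1_if_eq:
  fixes a :: "real \<Rightarrow> real"
  assumes "baire1 f" "baire1 h" and a: "continuous_on UNIV a"
  shows "baire1 (\<lambda>t. if a t = c then h t else f t)"
proof -
  obtain F where F: "\<And>n. continuous_on UNIV (F n)" "\<And>x. (\<lambda>n. F n x) \<longlonglongrightarrow> f x"
    using assms(1) unfolding baire1_def by blast
  obtain H where H: "\<And>n. continuous_on UNIV (H n)" "\<And>x. (\<lambda>n. H n x) \<longlonglongrightarrow> h x"
    using assms(2) unfolding baire1_def by blast
  define i where "i n t = max 0 (1 - real n * \<bar>a t - c\<bar>)" for n t
  have i: "(\<lambda>n. i n t) \<longlonglongrightarrow> (if a t = c then 1 else 0)" for t
  proof (cases "a t = c")
    case False
    then have "eventually (\<lambda>n. 1 / \<bar>a t - c\<bar> \<le> real n) sequentially"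
      using filterlim_real_sequentially unfolding filterlim_at_top by blast
    then have "eventually (\<lambda>n. i n t = 0) sequentially"
      by eventually_elim (use False in \<open>auto simp: i_def field_simps\<close>)
    then show ?thesis using False tendsto_eventually by auto
  qed (simp add: i_def)
  define G where "G n t = F n t + i n t * (H n t - F n t)" for n t
  have "continuous_on UNIV (G n)" for n
    unfolding G_def i_def by (intro continuous_intros F(1) H(1) a)
  moreover have "(\<lambda>n. G n t) \<longlonglongrightarrow> (if a t = c then h t else f t)" for t
  proof -
    have "(\<lambda>n. G n t) \<longlonglongrightarrow> f t + (if a t = c then 1 else 0) * (h t - f t)"
      unfolding G_def by (intro tendsto_intros F(2) H(2) i)
    then show ?thesis by (cases "a t = c") auto
  qed
  ultimately show ?thesis unfolding baire1_def by blast
qed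

section \<open>Representations\<close>

lemma representableE:
  assumes "representable A r"
  obtains \<Phi> where "\<And>x. x \<in> A \<Longrightarrow> baire1 (\<Phi> x)" "inj_on \<Phi> A"
    "\<And>x y. x \<in> A \<Longrightarrow> y \<in> A \<Longrightarrow> (x, y) \<in> r \<longleftrightarrow> \<Phi> x \<le> \<Phi> y"
proof -
  obtain F \<Phi> where F: "\<forall>f\<in>F. baire1 f" "bij_betw \<Phi> A F"
    "\<forall>x\<in>A. \<forall>y\<in>A. (x, y) \<in> r \<longleftrightarrow> (\<Phi> x, \<Phi> y) \<in> type_order_on F"
    using assms unfolding representable_def similar_def by blast
  then have "\<And>x. x \<in> A \<Longrightarrow> \<Phi> x \<in> F" by (auto simp: bij_betw_def)
  then show thesis
    using F by (intro that[of \<Phi>]) (auto simp: bij_betw_def type_order_on_def)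
qed

lemma representableI:
  assumes lin: "linear_order_on A r"
    and B: "\<And>x. x \<in> A \<Longrightarrow> baire1 (\<Phi> x)"
    and inj: "inj_on \<Phi> A"
    and mono: "\<And>x y. (x, y) \<in> r \<Longrightarrow> \<Phi> x \<le> \<Phi> y"
  shows "representable A r"
proof -
  have tot: "(x, y) \<in> r \<or> (y, x) \<in> r" if "x \<in> A" "y \<in> A" for x y
    using lin that unfolding order_on_defs total_on_def refl_on_def by metis
  have iff: "(x, y) \<in> r \<longleftrightarrow> \<Phi> x \<le> \<Phi> y" if "x \<in> A" "y \<in> A" for x y
  proof
    assume le: "\<Phi> x \<le> \<Phi> y"
    show "(x, y) \<in> r"
    proof (rule ccontr)
      assume "(x, y) \<notin> r"
      with tot that have yx: "(y, x) \<in> r" by blast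
      with mono le have "\<Phi> x = \<Phi> y" by (simp add: antisym)
      with inj that have "x = y" by (auto dest: inj_onD)
      with yx \<open>(x, y) \<notin> r\<close> show False by simp
    qed
  qed (rule mono)
  have "linear_order_on (\<Phi> ` A) (type_order_on (\<Phi> ` A))"
    unfolding order_on_defs
  proof (intro conjI)
    show "total_on (\<Phi> ` A) (type_order_on (\<Phi> ` A))"
      using tot mono by (fastforce simp: total_on_def type_order_on_def)
    show "trans (type_order_on (\<Phi> ` A))"
      by (rule transI) (auto simp: type_order_on_def intro: order_trans)
  qed (auto simp: refl_on_def antisym_def type_order_on_def)
  moreover have "similar A r (\<Phi> ` A) (type_order_on (\<Phi> ` A))"
    unfolding similar_def using inj iff
    by (intro exI[of _ \<Phi>]) (auto simp: bij_betw_def type_order_on_def)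
  ultimately show ?thesis
    unfolding representable_def using B by blast
qed

section \<open>A continuous surjection of the line onto the plane\<close>

text \<open>The triangle wave of period 2 that is the identity on \<open>[0, 1]\<close>.\<close>

definition triangle_wave :: "real \<Rightarrow> real" where
  "triangle_wave t = arccos (cos (pi * t)) / pi"

text \<open>A wave of period 2 that is 0 on \<open>[0, 1/3]\<close> and 1 on \<open>[2/3, 1]\<close>: on the Cantor set it
  reads off half of the first ternary digit.\<close>

definition digit_wave :: "real \<Rightarrow> real" where
  "digit_wave t = max 0 (min 1 (3 * triangle_wave t - 1))"

text \<open>The first coordinate of Schoenberg's curve; the second one is \<open>\<lambda>t. schoenberg (3 * t)\<close>.\<close>

definition schoenberg :: "real \<Rightarrow> real" where
  "schoenberg t = (\<Sum>n. digit_wave (9 ^ n * t) * (1 / 2) ^ Suc n)"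

text \<open>The point of the Cantor set with ternary digits \<open>2 * d n\<close>.\<close>

definition cantor :: "(nat \<Rightarrow> nat) \<Rightarrow> real" where
  "cantor d = (\<Sum>n. 2 * real (d n) * (1 / 3) ^ Suc n)"

lemma continuous_on_triangle: "continuous_on UNIV triangle_wave"
  unfolding triangle_wave_def by (intro continuous_intros) auto

lemma continuous_on_digit_wave: "continuous_on UNIV digit_wave"
  unfolding digit_wave_def by (intro continuous_intros continuous_on_triangle)

lemma triangle_wave_periodic:
  assumes "0 \<le> s" "s \<le> 1"
  shows "triangle_wave (s + 2 * real j) = s"
proof -
  have "pi * (s + 2 * real j) = pi * s + 2 * real j * pi" by (simp add: algebra_simps)
  then have "cos (pi * (s + 2 * real j)) = cos (pi * s)"
    by (simp add: cos_add)
  moreover have "arccos (cos (pi * s)) = pi * s"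
    using assms by (intro arccos_cos) (auto simp: mult_left_le)
  ultimately show ?thesis by (simp add: triangle_wave_def)
qed

lemma continuous_on_schoenberg: "continuous_on UNIV schoenberg"
proof -
  have w: "\<bar>digit_wave u\<bar> \<le> 1" for u by (auto simp: digit_wave_def)
  have lim: "uniform_limit UNIV (\<lambda>k t. \<Sum>n<k. digit_wave (9 ^ n * t) * (1 / 2) ^ Suc n)
      schoenberg sequentially"
    unfolding schoenberg_def
  proof (rule Weierstrass_m_test)
    show "norm (digit_wave (9 ^ n * t) * (1 / 2) ^ Suc n) \<le> (1 / 2) ^ Suc n" for n t
      using mult_right_mono[OF w, of "(1 / 2) ^ Suc n"] by (simp add: abs_mult)
    show "summable (\<lambda>n. (1 / 2 :: real) ^ Suc n)"
      by (subst summable_Suc_iff) (simp add: summable_geometric)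
  qed
  have "continuous_on UNIV (\<lambda>t. \<Sum>n<k. digit_wave (9 ^ n * t) * (1 / 2) ^ Suc n)" for k
    by (intro continuous_intros continuous_on_compose2[OF continuous_on_digit_wave]) auto
  then show ?thesis
    using uniform_limit_theorem[OF _ lim] by simp
qed

lemma
  assumes "\<And>n. d n \<le> 1"
  shows cantor_unfold: "cantor d = (2 * real (d 0) + cantor (\<lambda>n. d (Suc n))) / 3"
    and cantor_bounds: "0 \<le> cantor d" "cantor d \<le> 1"
proof -
  have g: "(\<lambda>n. 2 * (1 / 3 :: real) ^ Suc n) sums 1"
    using sums_mult[OF geometric_sums[of "1 / 3 :: real"], of "2 / 3"] by simp
  have sm: "summable (\<lambda>n. 2 * real (e n) * (1 / 3) ^ Suc n)"
    if e: "\<And>n. e n \<le> 1" for e :: "nat \<Rightarrow> nat"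
    by (rule summable_comparison_test'[OF sums_summable[OF g]]) (use e in \<open>auto simp: mult_le_cancel_right1\<close>)
  have "cantor d = 2 * real (d 0) * (1 / 3) ^ Suc 0
      + (\<Sum>n. 2 * real (d (Suc n)) * (1 / 3) ^ Suc (Suc n))"
    unfolding cantor_def using suminf_split_head[OF sm[of d]] assms by simp
  also have "(\<Sum>n. 2 * real (d (Suc n)) * (1 / 3) ^ Suc (Suc n))
      = (\<Sum>n. 2 * real (d (Suc n)) * (1 / 3) ^ Suc n) * (1 / 3)"
    using suminf_mult2[OF sm[of "\<lambda>n. d (Suc n)"], of "1 / 3"] assms by (simp add: mult_ac)
  finally show "cantor d = (2 * real (d 0) + cantor (\<lambda>n. d (Suc n))) / 3"
    by (simp add: cantor_def)
  show "0 \<le> cantor d"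
    unfolding cantor_def using assms by (intro suminf_nonneg sm) auto
  have "cantor d \<le> (\<Sum>n. 2 * (1 / 3 :: real) ^ Suc n)"
    unfolding cantor_def using assms
    by (intro suminf_le sm sums_summable[OF g]) (auto simp: mult_le_cancel_right1)
  then show "cantor d \<le> 1" using sums_unique[OF g] by simp
qed

lemma digit_wave_cantor:
  assumes d: "\<And>n. d n \<le> 1"
  shows "digit_wave (cantor d + 2 * real j) = real (d 0)"
proof -
  have "triangle_wave (cantor d + 2 * real j) = cantor d"
    using cantor_bounds[of d, OF d] by (intro triangle_wave_periodic) auto
  then have "digit_wave (cantor d + 2 * real j)
      = max 0 (min 1 (2 * real (d 0) + cantor (\<lambda>n. d (Suc n)) - 1))"
    unfolding digit_wave_def by (simp add: cantor_unfold[of d, OF d])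
  moreover have "d 0 = 0 \<or> d 0 = 1" using d[of 0] by linarith
  ultimately show ?thesis
    using cantor_bounds[of "\<lambda>n. d (Suc n)", OF d] by auto
qed

text \<open>Multiplication by 3 shifts the ternary digits, up to an even integer, which the waves
  do not see.\<close>

lemma power3_mult_cantor:
  assumes d: "\<And>n. d n \<le> 1"
  shows "\<exists>j'. 3 ^ k * (cantor d + 2 * real j) = cantor (\<lambda>n. d (n + k)) + 2 * real j'"
proof (induction k)
  case (Suc k)
  then obtain j' where
    "3 ^ k * (cantor d + 2 * real j) = cantor (\<lambda>n. d (n + k)) + 2 * real j'" by blast
  then have "3 ^ Suc k * (cantor d + 2 * real j)
      = cantor (\<lambda>n. d (n + Suc k)) + 2 * real (d k + 3 * j')"
    using cantor_unfold[of "\<lambda>n. d (n + k)", OF d] by (simp add: algebra_simps)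
  then show ?case by blast
qed auto

lemma digit_wave_power3_mult_cantor:
  assumes d: "\<And>n. d n \<le> 1"
  shows "digit_wave (3 ^ k * (cantor d + 2 * real j)) = real (d k)"
proof -
  obtain j' where
    "3 ^ k * (cantor d + 2 * real j) = cantor (\<lambda>n. d (n + k)) + 2 * real j'"
    using power3_mult_cantor[of d k j, OF d] by blast
  then show ?thesis using digit_wave_cantor[of "\<lambda>n. d (n + k)", OF d] by simp
qed

lemma binary_expansion:
  fixes u :: real
  assumes "0 \<le> u" "u < 1"
  obtains d :: "nat \<Rightarrow> nat"
    where "\<And>n. d n \<le> 1" "(\<lambda>n. real (d n) * (1 / 2) ^ Suc n) sums u"
proof
  define d where "d n = nat (\<lfloor>2 ^ Suc n * u\<rfloor> - 2 * \<lfloor>2 ^ n * u\<rfloor>)" for n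
  have fl: "\<lfloor>2 ^ Suc n * u\<rfloor> - 2 * \<lfloor>2 ^ n * u\<rfloor> \<in> {0, 1}" for n
  proof -
    have "2 ^ Suc n * u = 2 * (2 ^ n * u)" by simp
    moreover have "\<lfloor>2 * v\<rfloor> - 2 * \<lfloor>v\<rfloor> \<in> {0, 1}" for v :: real by (simp, linarith)
    ultimately show ?thesis by metis
  qed
  show "d n \<le> 1" for n using fl[of n] by (auto simp: d_def)
  have d: "real (d n) = of_int \<lfloor>2 ^ Suc n * u\<rfloor> - 2 * of_int \<lfloor>2 ^ n * u\<rfloor>" for n
    using fl[of n] by (auto simp: d_def)
  have part: "(\<Sum>n<k. real (d n) * (1 / 2) ^ Suc n) = of_int \<lfloor>2 ^ k * u\<rfloor> * (1 / 2) ^ k" for k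
  proof (induction k)
    case 0
    have "\<lfloor>u\<rfloor> = 0" using assms by linarith
    then show ?case by simp
  next
    case (Suc k)
    then show ?case by (simp add: d algebra_simps)
  qed
  have "(\<lambda>k. of_int \<lfloor>2 ^ k * u\<rfloor> * (1 / 2) ^ k) \<longlonglongrightarrow> u"
  proof (rule tendsto_sandwich)
    have eq: "u = 2 ^ k * u * (1 / 2) ^ k" for k
      by (simp add: power_one_over)
    show "\<forall>\<^sub>F k in sequentially. u - (1 / 2) ^ k \<le> of_int \<lfloor>2 ^ k * u\<rfloor> * (1 / 2) ^ k"
    proof (intro always_eventually allI)
      fix k
      have "(2 ^ k * u - 1) * (1 / 2) ^ k \<le> of_int \<lfloor>2 ^ k * u\<rfloor> * (1 / 2) ^ k"
        by (intro mult_right_mono) (linarith, simp)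
      then show "u - (1 / 2) ^ k \<le> of_int \<lfloor>2 ^ k * u\<rfloor> * (1 / 2) ^ k"
        using eq[of k] by (simp add: left_diff_distrib)
    qed
    show "\<forall>\<^sub>F k in sequentially. of_int \<lfloor>2 ^ k * u\<rfloor> * (1 / 2) ^ k \<le> u"
    proof (intro always_eventually allI)
      fix k
      have "of_int \<lfloor>2 ^ k * u\<rfloor> * (1 / 2) ^ k \<le> 2 ^ k * u * (1 / 2) ^ k"
        by (intro mult_right_mono) auto
      then show "of_int \<lfloor>2 ^ k * u\<rfloor> * (1 / 2) ^ k \<le> u" using eq[of k] by simp
    qed
    have "(\<lambda>k. (1 / 2 :: real) ^ k) \<longlonglongrightarrow> 0" by (rule LIMSEQ_power_zero) simp
    then show "(\<lambda>k. u - (1 / 2) ^ k) \<longlonglongrightarrow> u" by (auto intro: tendsto_eq_intros)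
  qed simp
  then show "(\<lambda>n. real (d n) * (1 / 2) ^ Suc n) sums u"
    unfolding sums_def part .
qed

text \<open>Schoenberg's curve covers the half-open unit square on each interval
  \<open>[2 j, 2 j + 1]\<close>: interleave the binary digits of the two coordinates.\<close>

lemma schoenberg_surj:
  assumes "0 \<le> u" "u < 1" "0 \<le> v" "v < 1"
  obtains s where "0 \<le> s" "s \<le> 1"
    "schoenberg (s + 2 * real j) = u" "schoenberg (3 * (s + 2 * real j)) = v"
proof -
  obtain d where d: "\<And>n. d n \<le> 1" "(\<lambda>n. real (d n) * (1 / 2) ^ Suc n) sums u"
    using binary_expansion assms by blast
  obtain e where e: "\<And>n. e n \<le> 1" "(\<lambda>n. real (e n) * (1 / 2) ^ Suc n) sums v"
    using binary_expansion assms by blast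
  define c where "c n = (if even n then d (n div 2) else e (n div 2))" for n
  have c: "c n \<le> 1" for n using d(1) e(1) by (simp add: c_def)
  have pow: "(9 :: real) ^ n = 3 ^ (2 * n)" for n by (simp add: power_mult)
  have "digit_wave (9 ^ n * (cantor c + 2 * real j)) = real (d n)" for n
    using digit_wave_power3_mult_cantor[of c "2 * n", OF c] by (simp add: pow c_def)
  then have u: "schoenberg (cantor c + 2 * real j) = u"
    using sums_unique[OF d(2)] by (simp add: schoenberg_def)
  have "digit_wave (9 ^ n * (3 * (cantor c + 2 * real j))) = real (e n)" for n
  proof -
    have "9 ^ n * (3 * (cantor c + 2 * real j)) = 3 ^ Suc (2 * n) * (cantor c + 2 * real j)"
      by (simp add: pow)
    then show ?thesis
      using digit_wave_power3_mult_cantor[of c "Suc (2 * n)", OF c] by (simp add: c_def)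
  qed
  then have "schoenberg (3 * (cantor c + 2 * real j)) = v"
    using sums_unique[OF e(2)] by (simp add: schoenberg_def)
  with u show thesis using that cantor_bounds[of c, OF c] by blast
qed

text \<open>The factor \<open>t - triangle_wave t\<close> is constantly \<open>2 j\<close> on \<open>[2 j, 2 j + 1]\<close>, so that there the
  rescaled curve covers the square \<open>[- 2 j, 2 j)\<^sup>2\<close>.\<close>

lemma continuous_surjection_plane:
  obtains a b :: "real \<Rightarrow> real"
  where "continuous_on UNIV a" "continuous_on UNIV b" "\<And>u v. \<exists>t. a t = u \<and> b t = v"
proof
  let ?a = "\<lambda>t. (t - triangle_wave t) * (2 * schoenberg t - 1)"
  let ?b = "\<lambda>t. (t - triangle_wave t) * (2 * schoenberg (3 * t) - 1)"
  show "continuous_on UNIV ?a"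
    by (intro continuous_intros continuous_on_triangle continuous_on_schoenberg)
  show "continuous_on UNIV ?b"
    by (intro continuous_intros continuous_on_triangle
        continuous_on_compose2[OF continuous_on_schoenberg]) auto
  fix u v :: real
  obtain j :: nat where j: "\<bar>u\<bar> + \<bar>v\<bar> < real j" using reals_Archimedean2 by blast
  then have pos: "real j > 0" by linarith
  define u' v' where "u' = (u / (2 * real j) + 1) / 2" and "v' = (v / (2 * real j) + 1) / 2"
  have "0 \<le> u'" "u' < 1" "0 \<le> v'" "v' < 1"
    using j pos unfolding u'_def v'_def by (auto simp: field_simps)
  then obtain s where s: "0 \<le> s" "s \<le> 1"
    "schoenberg (s + 2 * real j) = u'" "schoenberg (3 * (s + 2 * real j)) = v'"
    by (rule schoenberg_surj)
  have "?a (s + 2 * real j) = u" "?b (s + 2 * real j) = v"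
    unfolding triangle_wave_periodic[OF s(1,2)] s(3,4)
    using pos by (simp_all add: u'_def v'_def field_simps)
  then show "\<exists>t. ?a t = u \<and> ?b t = v" by blast
qed

section \<open>Replacing points by representable orders\<close>

text \<open>An increasing homeomorphism of \<open>\<real>\<close> onto the open interval \<open>(0, 1)\<close>; openness keeps the copy of
  \<open>Y\<^sub>x\<close> strictly below \<open>g\<^sub>x\<close>.\<close>

definition squash :: "real \<Rightarrow> real" where
  "squash u = 1 / 2 + arctan u / pi"

lemma squash: "0 < squash u" "squash u < 1" "squash u \<le> squash v \<longleftrightarrow> u \<le> v"
  using arctan_bounded[of u] by (auto simp: squash_def field_simps arctan_le_iff)

lemma continuous_on_squash: "continuous_on UNIV squash"
  unfolding squash_def by (intro continuous_intros) auto

theorem mainTheorem4: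
  fixes X :: "'a set" and r :: "'a rel"
    and Y :: "'a \<Rightarrow> 'b set" and s :: "'a \<Rightarrow> 'b rel"
  assumes "linear_order_on X r"
    and "representable (X \<times> {0, 1}) (duplication_order X r)"
    and "\<And>x. x \<in> X \<Longrightarrow> linear_order_on (Y x) (s x)"
    and "\<And>x. x \<in> X \<Longrightarrow> representable (Y x) (s x)"
  shows "representable (Sigma X Y) (lex_order X r Y s)"
proof -
  obtain D where D: "\<And>p. p \<in> X \<times> {0, 1} \<Longrightarrow> baire1 (D p)" "inj_on D (X \<times> {0, 1})"
    "\<And>p q. p \<in> X \<times> {0, 1} \<Longrightarrow> q \<in> X \<times> {0, 1} \<Longrightarrow>
       (p, q) \<in> duplication_order X r \<longleftrightarrow> D p \<le> D q"
    using representableE[OF assms(2)] by blast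
  define f g where "f x = D (x, 0)" and "g x = D (x, 1)" for x
  have f: "baire1 (f x)" if "x \<in> X" for x using D(1) that by (simp add: f_def)
  have fg: "f x \<le> g x" if "x \<in> X" for x
    using D(3)[of "(x, 0)" "(x, 1)"] that
    by (simp add: f_def g_def duplication_order_def lex_order_def type_order_on_def)
  have gf: "g x \<le> f x'" if "(x, x') \<in> r" "x \<noteq> x'" "x \<in> X" "x' \<in> X" for x x'
    using D(3)[of "(x, 1)" "(x', 0)"] that
    by (simp add: f_def g_def duplication_order_def lex_order_def)
  have "\<exists>c. f x c < g x c" if "x \<in> X" for x
  proof -
    have "f x \<noteq> g x" using D(2) that by (auto simp: f_def g_def dest: inj_onD)
    then have "\<not> g x \<le> f x" using fg[OF that] by auto
    then show ?thesis by (auto simp: le_fun_def not_le)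
  qed
  then obtain c where c: "\<And>x. x \<in> X \<Longrightarrow> f x (c x) < g x (c x)" by metis
  have "\<forall>x\<in>X. \<exists>h. (\<forall>y\<in>Y x. baire1 (h y)) \<and> inj_on h (Y x) \<and>
      (\<forall>y\<in>Y x. \<forall>y'\<in>Y x. (y, y') \<in> s x \<longleftrightarrow> h y \<le> h y')"
  proof
    fix x assume "x \<in> X"
    from representableE[OF assms(4)[OF this]]
    show "\<exists>h. (\<forall>y\<in>Y x. baire1 (h y)) \<and> inj_on h (Y x) \<and>
      (\<forall>y\<in>Y x. \<forall>y'\<in>Y x. (y, y') \<in> s x \<longleftrightarrow> h y \<le> h y')" by metis
  qed
  then obtain h where h:
    "\<And>x y. x \<in> X \<Longrightarrow> y \<in> Y x \<Longrightarrow> baire1 (h x y)"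
    "\<And>x. x \<in> X \<Longrightarrow> inj_on (h x) (Y x)"
    "\<And>x y y'. x \<in> X \<Longrightarrow> y \<in> Y x \<Longrightarrow> y' \<in> Y x \<Longrightarrow> (y, y') \<in> s x \<longleftrightarrow> h x y \<le> h x y'"
    unfolding bchoice_iff by blast
  obtain a b :: "real \<Rightarrow> real" where ab: "continuous_on UNIV a" "continuous_on UNIV b"
    "\<And>u v. \<exists>t. a t = u \<and> b t = v"
    using continuous_surjection_plane by blast
  \<comment> \<open>the copy of \<open>h x y\<close> inside the open interval between \<open>f x (c x)\<close> and \<open>g x (c x)\<close>\<close>
  define k where "k x y t = f x (c x) + (g x (c x) - f x (c x)) * squash (h x y (b t))" for x y t
  define \<Phi> where "\<Phi> = (\<lambda>(x, y) t. if a t = c x then k x y t else f x (a t))"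
  have k_gt: "f x (c x) < k x y t" if "x \<in> X" for x y t
    using c[OF that] squash(1) by (simp add: k_def)
  have k_less: "k x y t < g x (c x)" if "x \<in> X" for x y t
  proof -
    have "(g x (c x) - f x (c x)) * squash (h x y (b t)) < (g x (c x) - f x (c x)) * 1"
      using c[OF that] squash(2) by (intro mult_strict_left_mono) auto
    then show ?thesis by (simp add: k_def)
  qed
  have k_le: "k x y t \<le> k x y' t \<longleftrightarrow> h x y (b t) \<le> h x y' (b t)" if "x \<in> X" for x y y' t
    using c[OF that] squash(3) by (simp add: k_def mult_le_cancel_left_pos)
  have lower: "f x (a t) \<le> \<Phi> (x, y) t" and upper: "\<Phi> (x, y) t \<le> g x (a t)"
    if "x \<in> X" for x y t
    using k_gt[OF that, of y t] k_less[OF that, of y t] fg[OF that]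
    by (auto simp: \<Phi>_def le_fun_def)
  have cross: "\<Phi> (x, y) \<le> \<Phi> (x', y') \<and> \<Phi> (x, y) \<noteq> \<Phi> (x', y')"
    if "(x, x') \<in> r" "x \<noteq> x'" "x \<in> X" "x' \<in> X" for x y x' y'
  proof -
    have mid: "g x (a t) \<le> \<Phi> (x', y') t" for t
      using gf[OF that] lower[OF that(4), of t y'] by (meson le_funD order_trans)
    obtain t where t: "a t = c x" using ab(3) by blast
    then have "\<Phi> (x, y) t < g x (a t)"
      using k_less[OF that(3)] by (simp add: \<Phi>_def)
    with mid[of t] have "\<Phi> (x, y) \<noteq> \<Phi> (x', y')" by auto
    with mid upper[OF that(3)] show ?thesis by (meson le_funI order_trans)
  qed
  have fibre: "\<Phi> (x, y) \<le> \<Phi> (x, y') \<longleftrightarrow> h x y \<le> h x y'" if "x \<in> X" for x y y'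
  proof
    assume le: "\<Phi> (x, y) \<le> \<Phi> (x, y')"
    show "h x y \<le> h x y'"
    proof (rule le_funI)
      fix v
      obtain t where t: "a t = c x" "b t = v" using ab(3) by blast
      with le_funD[OF le, of t] show "h x y v \<le> h x y' v"
        using k_le[OF that] by (simp add: \<Phi>_def)
    qed
  next
    assume "h x y \<le> h x y'"
    then show "\<Phi> (x, y) \<le> \<Phi> (x, y')"
      using k_le[OF that] by (auto simp: \<Phi>_def le_fun_def)
  qed
  show ?thesis
  proof (rule representableI)
    show "linear_order_on (Sigma X Y) (lex_order X r Y s)"
      using assms(1,3) by (rule linear_order_on_lex_order)
  next
    fix p assume "p \<in> Sigma X Y"
    then obtain x y where p: "p = (x, y)" "x \<in> X" "y \<in> Y x" by blast
    have "continuous_on UNIV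
        (\<lambda>z. f x (c x) + (g x (c x) - f x (c x)) * squash z)"
      by (intro continuous_intros continuous_on_squash)
    from baire1_compose_left[OF baire1_compose_right[OF h(1)[OF p(2,3)] ab(2)] this]
    have "baire1 (k x y)" by (simp add: k_def[abs_def])
    with baire1_compose_right[OF f[OF p(2)] ab(1)] show "baire1 (\<Phi> p)"
      unfolding p(1) \<Phi>_def by (auto intro: baire1_if_eq ab(1))
  next
    show "inj_on \<Phi> (Sigma X Y)"
    proof (rule inj_onI)
      fix p q assume pq: "p \<in> Sigma X Y" "q \<in> Sigma X Y" "\<Phi> p = \<Phi> q"
      obtain x y x' y' where [simp]: "p = (x, y)" "q = (x', y')" by (cases p; cases q)
      have x: "x \<in> X" "x' \<in> X" "y \<in> Y x" "y' \<in> Y x'" using pq by auto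
      have "x = x'"
      proof (rule ccontr)
        assume "x \<noteq> x'"
        then have "(x, x') \<in> r \<or> (x', x) \<in> r"
          using assms(1) x unfolding order_on_defs total_on_def by blast
        then show False
          using cross[of x x' y y'] cross[of x' x y' y] \<open>x \<noteq> x'\<close> x pq(3) by auto
      qed
      moreover have "h x y = h x y'"
        using fibre[OF x(1), of y y'] fibre[OF x(1), of y' y] pq(3) \<open>x = x'\<close>
        by (simp add: antisym)
      ultimately show "p = q" using h(2)[OF x(1)] x by (auto dest: inj_onD)
    qed
  next
    fix p q assume "(p, q) \<in> lex_order X r Y s"
    then show "\<Phi> p \<le> \<Phi> q"
      using cross fibre h(3) by (auto simp: lex_order_def)
  qed
qed

end
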